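(* Suppose system $(\Sigma)$ has stochastic relative degree $r$ at $\bar x$ and that the row vectors $\frac{\partial h}{\partial x}(\bar x),\frac{\partial \mathcal S_{f,l}h}{\partial x}(\bar x),\dots,\frac{\partial \mathcal S^{r-1}_{f,l}h}{\partial x}(\bar x)$ are linearly independent. Set $\phi_i(x)=\mathcal S^{i-1}_{f,l}h(x)$ for $i=1,\dots,r$. If $r<n$, there exist smooth real-valued functions $\phi_{r+1},\dots,\phi_n$ such that the Jacobian of $\Phi(x)=[\phi_1(x),\dots,\phi_n(x)]^\top$ is invertible at $\bar x$, so that $\Phi$ is a coordinate transformation on a neighbourhood of $\bar x$. In the coordinates $z_t=\Phi(x_t)$ system $(\Sigma)$ reads $$\dot z_i=z_{i+1}\ (i=1,\dots,r-1),\quad \dot z_r=c(\xi_t,z_t)+b(\xi_t,z_t)u+a(z_t)u^2,$$ $$\dot z_j=p_j(\xi_t,z_t)+q_j(\xi_t,z_t)u+s_j(z_t)u^2\ (j=r+1,\dots,n),\quad y_t=z_1,$$ where $c(\xi,z)=\mathcal S^r_{f,l}h(\xi,\Phi^{-1}(z))$, $b(\xi,z)=\mathcal A_{l,m,g}\mathcal S^{r-1}_{f,l}h(\xi,\Phi^{-1}(z))$, $a(z)=\frac12H_{m,m}\mathcal S^{r-1}_{f,l}h(\Phi^{-1}(z))$, $p_j(\xi,z)=\mathcal S_{f,l}\phi_j(\xi,\Phi^{-1}(z))$, $q_j(\xi,z)=\mathcal A_{l,m,g}\phi_j(\xi,\Phi^{-1}(z))$, $s_j(z)=\frac12H_{m,m}\phi_j(\Phi^{-1}(z))$;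 in particular $c,b,p_j,q_j$ are affine in $\xi$.
   Context: System $(\Sigma)$: $dx_t=(f(x_t)+g(x_t)u)dt+(l(x_t)+m(x_t)u)d\mathcal W_t$, $y_t=h(x_t)$, Itô sense, $x_t\in\mathbb R^n$, $u,y_t\in\mathbb R$, all maps smooth, $\mathcal W_t$ scalar standard Brownian motion, unique solutions; equivalently $\dot x_t=f+gu+(l+mu)\xi_t$ with $\xi_t=\dot{\mathcal W}_t$ generalised white noise; derivatives computed by Itô's formula. Notation: $L_fh=\frac{\partial h}{\partial x}f$; $H_{f,g}h=g^\top\frac{\partial^2h}{\partial x^2}f$; $\mathcal S_{f,l}h(\xi,x)=L_fh(x)+L_lh(x)\xi+\frac12H_{l,l}h(x)$ (defined for any smooth $h$), iterates $\mathcal S^k_{f,l}h=\mathcal S_{f,l}\mathcal S^{k-1}_{f,l}h$ defined when $\mathcal S^{k-1}_{f,l}h$ does not depend on $\xi$, $\mathcal S^0_{f,l}h=h$; $\mathcal A_{l,m,g}h(\xi,x)=L_gh(x)+L_mh(x)\xi+H_{l,m}h(x)$. Stochastic relative degree $r$ at $\bar x$: (ND) $L_l\mathcal S^k_{f,l}h=0$ and $L_m\mathcal S^k_{f,l}h=0$ near $\bar x$ for $k\in\{0,\dots,r-2\}$; (CD) $L_g\mathcal S^k_{f,l}h+H_{l,m}\mathcal S^k_{f,l}h=0$, $L_m\mathcal S^k_{f,l}h=0$, $H_{m,m}\mathcal S^k_{f,l}h=0$ near $\bar x$ for $k\in\{0,\dots,r-2\}$; (RD) at $\bar x$, $L_g\mathcal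 S^{r-1}_{f,l}h+H_{l,m}\mathcal S^{r-1}_{f,l}h\ne0$ or $L_m\mathcal S^{r-1}_{f,l}h\ne0$ or $H_{m,m}\mathcal S^{r-1}_{f,l}h\ne0$. *)

theory Defs
  imports "HOL-Analysis.Analysis"
begin

text \<open>State space R^n is rendered as real^'n, with n = CARD('n).
  Vector fields are maps real^'n => real^'n, scalar functions real^'n => real.\<close>

definition pd :: "'n::finite \<Rightarrow> (real^'n \<Rightarrow> real) \<Rightarrow> real^'n \<Rightarrow> real" where
  "pd j h x = deriv (\<lambda>t. h (x + t *\<^sub>R axis j 1)) 0"

fun iter_pd :: "'n::finite list \<Rightarrow> (real^'n \<Rightarrow> real) \<Rightarrow> real^'n \<Rightarrow> real" where
  "iter_pd [] h = h"
| "iter_pd (j # js) h = pd j (iter_pd js h)"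

text \<open>C-infinity: every iterated partial derivative exists and is (Frechet) differentiable
  everywhere.\<close>
definition smooth_fun :: "(real^'n::finite \<Rightarrow> real) \<Rightarrow> bool" where
  "smooth_fun h \<longleftrightarrow> (\<forall>js x. iter_pd js h differentiable (at x))"

definition smooth_vf :: "(real^'n::finite \<Rightarrow> real^'n) \<Rightarrow> bool" where
  "smooth_vf f \<longleftrightarrow> (\<forall>i. smooth_fun (\<lambda>x. f x $ i))"

text \<open>Lie derivative L_f h = (dh/dx) f.\<close>
definition Lie :: "(real^'n::finite \<Rightarrow> real^'n) \<Rightarrow> (real^'n \<Rightarrow> real) \<Rightarrow> real^'n \<Rightarrow> real" where
  "Lie f h x = (\<Sum>j\<in>UNIV. pd j h x * f x $ j)"

text \<open>H_{f,g} h = g^T (d^2 h / dx^2) f.\<close>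
definition Hess :: "(real^'n::finite \<Rightarrow> real^'n) \<Rightarrow> (real^'n \<Rightarrow> real^'n) \<Rightarrow> (real^'n \<Rightarrow> real)
    \<Rightarrow> real^'n \<Rightarrow> real" where
  "Hess f g h x = (\<Sum>i\<in>UNIV. \<Sum>j\<in>UNIV. g x $ i * pd i (pd j h) x * f x $ j)"

text \<open>S_{f,l} h (xi, x) = L_f h + L_l h xi + 1/2 H_{l,l} h.\<close>
definition Sop :: "(real^'n::finite \<Rightarrow> real^'n) \<Rightarrow> (real^'n \<Rightarrow> real^'n) \<Rightarrow> (real^'n \<Rightarrow> real)
    \<Rightarrow> real \<Rightarrow> real^'n \<Rightarrow> real" where
  "Sop f l h \<xi> x = Lie f h x + Lie l h x * \<xi> + 1/2 * Hess l l h x"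

text \<open>Iterates S^k_{f,l} h as functions of x only; S^{k+1} h = S_{f,l}(S^k h) evaluated at
  xi = 0.  Under condition (ND) these coincide with the paper's iterates (which are
  xi-independent) for all k <= r-1.\<close>
fun Siter :: "nat \<Rightarrow> (real^'n::finite \<Rightarrow> real^'n) \<Rightarrow> (real^'n \<Rightarrow> real^'n) \<Rightarrow> (real^'n \<Rightarrow> real)
    \<Rightarrow> real^'n \<Rightarrow> real" where
  "Siter 0 f l h = h"
| "Siter (Suc k) f l h = (\<lambda>x. Sop f l (Siter k f l h) 0 x)"

text \<open>A_{l,m,g} h (xi, x) = L_g h + L_m h xi + H_{l,m} h.\<close>
definition Aop :: "(real^'n::finite \<Rightarrow> real^'n) \<Rightarrow> (real^'n \<Rightarrow> real^'n) \<Rightarrow> (real^'n \<Rightarrow> real^'n)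
    \<Rightarrow> (real^'n \<Rightarrow> real) \<Rightarrow> real \<Rightarrow> real^'n \<Rightarrow> real" where
  "Aop l m g h \<xi> x = Lie g h x + Lie m h x * \<xi> + Hess l m h x"

text \<open>Stochastic relative degree r at xbar (conditions ND, CD near xbar, RD at xbar).\<close>
definition stoch_rel_degree ::
  "(real^'n::finite \<Rightarrow> real^'n) \<Rightarrow> (real^'n \<Rightarrow> real^'n) \<Rightarrow> (real^'n \<Rightarrow> real^'n)
   \<Rightarrow> (real^'n \<Rightarrow> real^'n) \<Rightarrow> (real^'n \<Rightarrow> real) \<Rightarrow> nat \<Rightarrow> real^'n \<Rightarrow> bool" where
  "stoch_rel_degree f g l m h r xbar \<longleftrightarrow> r \<ge> 1 \<and>
     (\<exists>U. open U \<and> xbar \<in> U \<and> (\<forall>k. k + 2 \<le> r \<longrightarrow> (\<forall>x\<in>U.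
        Lie l (Siter k f l h) x = 0 \<and> Lie m (Siter k f l h) x = 0 \<and>
        Lie g (Siter k f l h) x + Hess l m (Siter k f l h) x = 0 \<and>
        Hess m m (Siter k f l h) x = 0))) \<and>
     (Lie g (Siter (r - 1) f l h) xbar + Hess l m (Siter (r - 1) f l h) xbar \<noteq> 0 \<or>
      Lie m (Siter (r - 1) f l h) xbar \<noteq> 0 \<or>
      Hess m m (Siter (r - 1) f l h) xbar \<noteq> 0)"

text \<open>Gradient (row vector dh/dx) at x.\<close>
definition grad :: "(real^'n::finite \<Rightarrow> real) \<Rightarrow> real^'n \<Rightarrow> real^'n" where
  "grad h x = (\<chi> j. pd j h x)"

text \<open>The family of row vectors (grad (\<phi> i) x), i \<in> I, is linearly independent.\<close>
definition rows_lin_indep :: "(nat \<Rightarrow> real^'n::finite \<Rightarrow> real) \<Rightarrow> nat set \<Rightarrow> real^'n \<Rightarrow> bool" where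
  "rows_lin_indep \<phi> I x \<longleftrightarrow> inj_on (\<lambda>i. grad (\<phi> i) x) I \<and> independent ((\<lambda>i. grad (\<phi> i) x) ` I)"

text \<open>Rate of change of \<phi>(x_t) along (\<Sigma>), computed by Ito's formula, in the generalised
  white-noise reading: d/dt \<phi>(x_t) = L_{f+gu} \<phi> + L_{l+mu} \<phi> \<xi>_t + 1/2 H_{l+mu,l+mu} \<phi>.\<close>
definition ito_rate ::
  "(real^'n::finite \<Rightarrow> real^'n) \<Rightarrow> (real^'n \<Rightarrow> real^'n) \<Rightarrow> (real^'n \<Rightarrow> real^'n)
   \<Rightarrow> (real^'n \<Rightarrow> real^'n) \<Rightarrow> (real^'n \<Rightarrow> real) \<Rightarrow> real \<Rightarrow> real \<Rightarrow> real^'n \<Rightarrow> real" where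
  "ito_rate f g l m \<phi> \<xi> u x =
     Lie (\<lambda>y. f y + u *\<^sub>R g y) \<phi> x + Lie (\<lambda>y. l y + u *\<^sub>R m y) \<phi> x * \<xi>
     + 1/2 * Hess (\<lambda>y. l y + u *\<^sub>R m y) (\<lambda>y. l y + u *\<^sub>R m y) \<phi> x"

end

theory Submission
  imports Defs
begin

text \<open>The gradients of h, S h, ..., S^(r-1) h at xbar are independent; completing them by
  linear coordinates v \<bullet> x, with v running through a basis completion, makes the Jacobian of
  \<Phi> invertible at xbar. A C^1 map with invertible derivative is locally injective, and invariance
  of domain then makes it a homeomorphism onto its image. Along (\<Sigma>), Ito's formula gives the
  rate S \<phi> + A \<phi> u + 1/2 H_{m,m} \<phi> u^2 once the Hessian is known to be symmetric (Schwarz);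
  for k \<le> r - 2 conditions (ND) and (CD) kill every \<xi>- and u-dependent term of the rate of
  S^k h, so that the first r coordinates form a chain of integrators.\<close>

section \<open>Partial derivatives and smooth functions\<close>

lemma has_real_derivative_along_line:
  fixes h :: "real^'n::finite \<Rightarrow> real"
  assumes "(h has_derivative D) (at (x + s *\<^sub>R a))"
  shows "((\<lambda>t. h (x + t *\<^sub>R a)) has_real_derivative D a) (at s)"
proof -
  have "((\<lambda>t. x + t *\<^sub>R a) has_derivative (\<lambda>t. t *\<^sub>R a)) (at s)"
    by (auto intro!: derivative_eq_intros)
  then have "((h \<circ> (\<lambda>t. x + t *\<^sub>R a)) has_derivative (D \<circ> (\<lambda>t. t *\<^sub>R a))) (at s)"
    by (rule diff_chain_at) (simp add: assms)
  moreover have "D \<circ> (\<lambda>t. t *\<^sub>R a) = (*) (D a)"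
  proof -
    interpret bounded_linear D using has_derivative_bounded_linear[OF assms] .
    show ?thesis by (auto simp: fun_eq_iff scaleR)
  qed
  ultimately show ?thesis by (simp add: has_field_derivative_def o_def)
qed

lemma pd_eq_derivative:
  fixes h :: "real^'n::finite \<Rightarrow> real"
  assumes "(h has_derivative D) (at x)"
  shows "pd j h x = D (axis j 1)"
  unfolding pd_def
  using has_real_derivative_along_line[of h D x 0 "axis j 1"] assms by (simp add: DERIV_imp_deriv)

lemma has_real_derivative_pd_along_axis:
  fixes h :: "real^'n::finite \<Rightarrow> real"
  assumes "h differentiable (at (x + s *\<^sub>R axis j 1))"
  shows "((\<lambda>t. h (x + t *\<^sub>R axis j 1)) has_real_derivative pd j h (x + s *\<^sub>R axis j 1)) (at s)"
proof -
  obtain D where D: "(h has_derivative D) (at (x + s *\<^sub>R axis j 1))"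
    using assms unfolding differentiable_def by blast
  show ?thesis using has_real_derivative_along_line[OF D] pd_eq_derivative[OF D] by simp
qed

lemma has_derivative_pd:
  fixes h :: "real^'n::finite \<Rightarrow> real"
  assumes "h differentiable (at x)"
  shows "(h has_derivative (\<lambda>v. \<Sum>j\<in>UNIV. pd j h x * v $ j)) (at x)"
proof -
  obtain D where D: "(h has_derivative D) (at x)"
    using assms unfolding differentiable_def by blast
  interpret bounded_linear D using has_derivative_bounded_linear[OF D] .
  have "D v = (\<Sum>j\<in>UNIV. pd j h x * v $ j)" for v
  proof -
    have "D v = D (\<Sum>j\<in>UNIV. v $ j *\<^sub>R axis j 1)"
      using basis_expansion[of v] by (simp add: scalar_mult_eq_scaleR)
    then show ?thesis by (simp add: sum scaleR pd_eq_derivative[OF D] mult.commute)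
  qed
  then have "D = (\<lambda>v. \<Sum>j\<in>UNIV. pd j h x * v $ j)" by blast
  with D show ?thesis by simp
qed

lemma pd_add:
  fixes a b :: "real^'n::finite \<Rightarrow> real"
  assumes "a differentiable (at x)" "b differentiable (at x)"
  shows "pd j (\<lambda>y. a y + b y) x = pd j a x + pd j b x"
proof -
  obtain Da Db where Da: "(a has_derivative Da) (at x)" and Db: "(b has_derivative Db) (at x)"
    using assms unfolding differentiable_def by blast
  show ?thesis
    using pd_eq_derivative[OF has_derivative_add[OF Da Db]] pd_eq_derivative[OF Da]
      pd_eq_derivative[OF Db] by simp
qed

lemma pd_mult:
  fixes a b :: "real^'n::finite \<Rightarrow> real"
  assumes "a differentiable (at x)" "b differentiable (at x)"
  shows "pd j (\<lambda>y. a y * b y) x = pd j a x * b x + a x * pd j b x"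
proof -
  obtain Da Db where Da: "(a has_derivative Da) (at x)" and Db: "(b has_derivative Db) (at x)"
    using assms unfolding differentiable_def by blast
  show ?thesis
    using pd_eq_derivative[OF has_derivative_mult[OF Da Db]] pd_eq_derivative[OF Da]
      pd_eq_derivative[OF Db] by simp
qed

lemma pd_const: "pd j (\<lambda>y::real^'n::finite. c) x = 0"
  using pd_eq_derivative[of "\<lambda>y. c" "\<lambda>_. 0"] by simp

lemma iter_pd_append: "iter_pd (js @ ks) h = iter_pd js (iter_pd ks h)"
  by (induction js) auto

lemma iter_pd_const:
  "iter_pd js (\<lambda>y::real^'n::finite. c) = (\<lambda>y. if js = [] then c else 0)"
proof (induction js)
  case (Cons j js)
  then show ?case by (cases "js = []") (simp_all add: pd_const)
qed simp

lemma iter_pd_add: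
  fixes a b :: "real^'n::finite \<Rightarrow> real"
  assumes "\<And>ks x. length ks < length js \<Longrightarrow>
             iter_pd ks a differentiable (at x) \<and> iter_pd ks b differentiable (at x)"
  shows "iter_pd js (\<lambda>x. a x + b x) = (\<lambda>x. iter_pd js a x + iter_pd js b x)"
  using assms
proof (induction js)
  case (Cons j js)
  then have "iter_pd js (\<lambda>x. a x + b x) = (\<lambda>x. iter_pd js a x + iter_pd js b x)"
    by force
  then show ?case using Cons.prems[of js] by (simp add: pd_add)
qed simp

lemma smooth_fun_differentiable: "smooth_fun h \<Longrightarrow> h differentiable (at x)"
  unfolding smooth_fun_def by (metis iter_pd.simps(1))

lemma smooth_fun_isCont: "smooth_fun h \<Longrightarrow> isCont h x"
  by (simp add: differentiable_imp_continuous_within smooth_fun_differentiable)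

lemma smooth_fun_pd: "smooth_fun h \<Longrightarrow> smooth_fun (pd j h)"
  unfolding smooth_fun_def using iter_pd_append[of _ "[j]" h] by (metis iter_pd.simps)

lemma smooth_funI_pd:
  assumes "\<And>x. h differentiable (at x)" "\<And>j. smooth_fun (pd j h)"
  shows "smooth_fun h"
  unfolding smooth_fun_def
proof (intro allI)
  fix js x
  show "iter_pd js h differentiable at x"
  proof (cases js rule: rev_cases)
    case (snoc ys j)
    then show ?thesis using assms(2)[of j] by (simp add: iter_pd_append smooth_fun_def)
  qed (simp add: assms(1))
qed

lemma smooth_fun_const: "smooth_fun (\<lambda>y::real^'n::finite. c)"
  unfolding smooth_fun_def iter_pd_const by simp

lemma smooth_fun_add: "smooth_fun a \<Longrightarrow> smooth_fun b \<Longrightarrow> smooth_fun (\<lambda>x. a x + b x)"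
  unfolding smooth_fun_def by (subst iter_pd_add) (auto intro!: differentiable_add)

lemma iter_pd_mult_differentiable:
  fixes h k :: "real^'n::finite \<Rightarrow> real"
  assumes "smooth_fun h" "smooth_fun k"
  shows "iter_pd js (\<lambda>x. h x * k x) differentiable (at x)"
  using assms
proof (induction js arbitrary: h k x rule: measure_induct_rule[of length])
  case (less js)
  show ?case
  proof (cases js rule: rev_cases)
    case Nil
    then show ?thesis by (simp add: differentiable_mult less.prems smooth_fun_differentiable)
  next
    case (snoc ys j)
    have "pd j (\<lambda>x. h x * k x) = (\<lambda>x. pd j h x * k x + h x * pd j k x)"
      using less.prems by (auto simp: fun_eq_iff intro!: pd_mult smooth_fun_differentiable)
    moreover have "iter_pd ys (\<lambda>x. pd j h x * k x + h x * pd j k x)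
       = (\<lambda>x. iter_pd ys (\<lambda>x. pd j h x * k x) x + iter_pd ys (\<lambda>x. h x * pd j k x) x)"
      using snoc less by (intro iter_pd_add) (simp add: smooth_fun_pd)
    ultimately show ?thesis
      using snoc less by (simp add: iter_pd_append smooth_fun_pd differentiable_add)
  qed
qed

lemma smooth_fun_mult: "smooth_fun a \<Longrightarrow> smooth_fun b \<Longrightarrow> smooth_fun (\<lambda>x. a x * b x)"
  by (simp add: iter_pd_mult_differentiable smooth_fun_def)

lemma smooth_fun_sum:
  "finite A \<Longrightarrow> (\<And>i. i \<in> A \<Longrightarrow> smooth_fun (F i)) \<Longrightarrow> smooth_fun (\<lambda>x. \<Sum>i\<in>A. F i x)"
  by (induction A rule: finite_induct) (auto simp: smooth_fun_const intro!: smooth_fun_add)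

lemma smooth_fun_Lie:
  assumes "smooth_vf f" "smooth_fun h"
  shows "smooth_fun (Lie f h)"
proof -
  have "Lie f h = (\<lambda>x. \<Sum>j\<in>UNIV. pd j h x * f x $ j)"
    by (simp add: fun_eq_iff Lie_def)
  then show ?thesis
    using assms unfolding smooth_vf_def by (auto intro!: smooth_fun_sum smooth_fun_mult smooth_fun_pd)
qed

lemma smooth_fun_Hess:
  assumes "smooth_vf f" "smooth_vf g" "smooth_fun h"
  shows "smooth_fun (Hess f g h)"
proof -
  have "Hess f g h = (\<lambda>x. \<Sum>i\<in>UNIV. \<Sum>j\<in>UNIV. g x $ i * pd i (pd j h) x * f x $ j)"
    by (simp add: fun_eq_iff Hess_def)
  then show ?thesis
    using assms unfolding smooth_vf_def by (auto intro!: smooth_fun_sum smooth_fun_mult smooth_fun_pd)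
qed

lemma smooth_fun_Siter:
  assumes "smooth_vf f" "smooth_vf l" "smooth_fun h"
  shows "smooth_fun (Siter k f l h)"
proof (induction k)
  case (Suc k)
  have "Siter (Suc k) f l h = (\<lambda>x. Lie f (Siter k f l h) x + (\<lambda>_. 1/2) x * Hess l l (Siter k f l h) x)"
    by (simp add: fun_eq_iff Sop_def)
  then show ?case
    using Suc assms
    by (simp only:) (intro smooth_fun_add smooth_fun_mult smooth_fun_Lie smooth_fun_Hess smooth_fun_const)
qed (simp add: assms)

lemma pd_inner: "pd j (\<lambda>x::real^'n::finite. v \<bullet> x) y = v $ j"
  using pd_eq_derivative[OF has_derivative_inner_right[OF has_derivative_ident]]
  by (simp add: inner_axis)

lemma smooth_fun_inner: "smooth_fun (\<lambda>x::real^'n::finite. v \<bullet> x)"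
proof (rule smooth_funI_pd)
  show "(\<lambda>x. v \<bullet> x) differentiable at x" for x
    using has_derivative_inner_right[OF has_derivative_ident] differentiable_def by blast
  have "pd j (\<lambda>x. v \<bullet> x) = (\<lambda>x. v $ j)" for j
    by (simp add: fun_eq_iff pd_inner)
  then show "smooth_fun (pd j (\<lambda>x. v \<bullet> x))" for j by (simp add: smooth_fun_const)
qed

lemma grad_inner: "grad (\<lambda>x::real^'n::finite. v \<bullet> x) y = v"
  by (simp add: grad_def pd_inner vec_eq_iff)

section \<open>Symmetry of the Hessian\<close>

lemma second_difference_mvt:
  fixes h :: "real^'n::finite \<Rightarrow> real"
  assumes dh: "\<And>y. h differentiable (at y)" and dhi: "\<And>y. pd i h differentiable (at y)"
    and s: "s > 0"
  shows "\<exists>\<sigma> \<tau>. 0 < \<sigma> \<and> \<sigma> < s \<and> 0 < \<tau> \<and> \<tau> < s \<and>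
    h (x + s *\<^sub>R axis i 1 + s *\<^sub>R axis j 1) - h (x + s *\<^sub>R axis j 1) - h (x + s *\<^sub>R axis i 1) + h x
      = s * s * pd j (pd i h) (x + \<sigma> *\<^sub>R axis i 1 + \<tau> *\<^sub>R axis j 1)"
proof -
  define e :: "real^'n" where "e = axis i 1"
  define d :: "real^'n" where "d = axis j 1"
  define g where "g = (\<lambda>\<sigma>. h (x + s *\<^sub>R d + \<sigma> *\<^sub>R e) - h (x + \<sigma> *\<^sub>R e))"
  define G' where "G' = (\<lambda>t. pd i h (x + s *\<^sub>R d + t *\<^sub>R e) - pd i h (x + t *\<^sub>R e))"
  have "(g has_real_derivative G' t) (at t)" for t
    unfolding g_def e_def G'_def by (intro DERIV_diff has_real_derivative_pd_along_axis dh)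
  then obtain \<sigma> where \<sigma>: "0 < \<sigma>" "\<sigma> < s"
    "g s - g 0 = s * (pd i h (x + s *\<^sub>R d + \<sigma> *\<^sub>R e) - pd i h (x + \<sigma> *\<^sub>R e))"
    using MVT2[of 0 s g G', OF s] unfolding G'_def by auto
  define k where "k = (\<lambda>\<tau>. pd i h (x + \<sigma> *\<^sub>R e + \<tau> *\<^sub>R d))"
  have "(k has_real_derivative pd j (pd i h) (x + \<sigma> *\<^sub>R e + t *\<^sub>R d)) (at t)" for t
    unfolding k_def d_def by (intro has_real_derivative_pd_along_axis dhi)
  then obtain \<tau> where \<tau>: "0 < \<tau>" "\<tau> < s"
    "k s - k 0 = s * pd j (pd i h) (x + \<sigma> *\<^sub>R e + \<tau> *\<^sub>R d)"
    using MVT2[of 0 s k "\<lambda>t. pd j (pd i h) (x + \<sigma> *\<^sub>R e + t *\<^sub>R d)", OF s] by auto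
  have swap_s: "x + s *\<^sub>R d + s *\<^sub>R e = x + s *\<^sub>R e + s *\<^sub>R d"
    and swap_\<sigma>: "x + s *\<^sub>R d + \<sigma> *\<^sub>R e = x + \<sigma> *\<^sub>R e + s *\<^sub>R d"
    by (simp_all add: algebra_simps)
  have "h (x + s *\<^sub>R e + s *\<^sub>R d) - h (x + s *\<^sub>R d) - h (x + s *\<^sub>R e) + h x = g s - g 0"
    unfolding g_def swap_s by simp
  also have "\<dots> = s * (k s - k 0)"
    using \<sigma>(3) unfolding k_def swap_\<sigma> by simp
  also have "\<dots> = s * s * pd j (pd i h) (x + \<sigma> *\<^sub>R e + \<tau> *\<^sub>R d)" using \<tau>(3) by simp
  finally show ?thesis using \<sigma> \<tau> unfolding e_def d_def by blast
qed

lemma norm_two_axis_steps_less: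
  assumes "0 < a" "a < s" "0 < b" "b < s"
  shows "norm (a *\<^sub>R axis p 1 + b *\<^sub>R axis q (1::real)) < 2 * s"
proof -
  have "norm (a *\<^sub>R axis p 1 + b *\<^sub>R axis q (1::real))
      \<le> norm (a *\<^sub>R axis p (1::real)) + norm (b *\<^sub>R axis q (1::real))"
    by (rule norm_triangle_ineq)
  also have "\<dots> = a + b" using assms by simp
  finally show ?thesis using assms by simp
qed

text \<open>Schwarz's theorem: by two mean value steps the second difference of h over a small square is
  s^2 times a mixed partial of either order at nearby points, and continuity forces the two mixed
  partials to agree.\<close>
lemma pd_pd_commute:
  fixes h :: "real^'n::finite \<Rightarrow> real"
  assumes sm: "smooth_fun h"
  shows "pd j (pd i h) x = pd i (pd j h) x"
proof (rule ccontr)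
  let ?A = "pd j (pd i h)" and ?B = "pd i (pd j h)"
  assume ne: "?A x \<noteq> ?B x"
  define \<epsilon> where "\<epsilon> = \<bar>?A x - ?B x\<bar> / 2"
  have \<epsilon>: "\<epsilon> > 0" using ne unfolding \<epsilon>_def by simp
  obtain d1 where d1: "d1 > 0" "\<And>y. dist y x < d1 \<Longrightarrow> dist (?A y) (?A x) < \<epsilon>"
    using smooth_fun_isCont[OF smooth_fun_pd[OF smooth_fun_pd[OF sm]]] \<epsilon>
    unfolding continuous_at_eps_delta by blast
  obtain d2 where d2: "d2 > 0" "\<And>y. dist y x < d2 \<Longrightarrow> dist (?B y) (?B x) < \<epsilon>"
    using smooth_fun_isCont[OF smooth_fun_pd[OF smooth_fun_pd[OF sm]]] \<epsilon>
    unfolding continuous_at_eps_delta by blast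
  define s where "s = min d1 d2 / 2"
  have s: "s > 0" using d1 d2 unfolding s_def by simp
  have near: "dist (x + a *\<^sub>R axis p 1 + b *\<^sub>R axis q 1) x < min d1 d2"
    if "0 < a" "a < s" "0 < b" "b < s" for a b and p q :: 'n
    using norm_two_axis_steps_less[OF that, of p q] by (simp add: dist_norm s_def)
  have dh: "\<And>y. h differentiable (at y)" and dhi: "\<And>y. pd i h differentiable (at y)"
    and dhj: "\<And>y. pd j h differentiable (at y)"
    using sm by (auto intro: smooth_fun_differentiable smooth_fun_pd)
  obtain \<sigma> \<tau> where st: "0 < \<sigma>" "\<sigma> < s" "0 < \<tau>" "\<tau> < s" and
    E1: "h (x + s *\<^sub>R axis i 1 + s *\<^sub>R axis j 1) - h (x + s *\<^sub>R axis j 1) - h (x + s *\<^sub>R axis i 1) + h x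
      = s * s * ?A (x + \<sigma> *\<^sub>R axis i 1 + \<tau> *\<^sub>R axis j 1)"
    using second_difference_mvt[OF dh dhi s, of x j] by blast
  obtain \<sigma>' \<tau>' where st': "0 < \<sigma>'" "\<sigma>' < s" "0 < \<tau>'" "\<tau>' < s" and
    E2: "h (x + s *\<^sub>R axis j 1 + s *\<^sub>R axis i 1) - h (x + s *\<^sub>R axis i 1) - h (x + s *\<^sub>R axis j 1) + h x
      = s * s * ?B (x + \<sigma>' *\<^sub>R axis j 1 + \<tau>' *\<^sub>R axis i 1)"
    using second_difference_mvt[OF dh dhj s, of x i] by blast
  have swap: "x + s *\<^sub>R axis j 1 + s *\<^sub>R axis i 1 = x + s *\<^sub>R axis i 1 + s *\<^sub>R axis j 1"
    by (simp add: algebra_simps)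
  have "s * s * ?A (x + \<sigma> *\<^sub>R axis i 1 + \<tau> *\<^sub>R axis j 1)
      = s * s * ?B (x + \<sigma>' *\<^sub>R axis j 1 + \<tau>' *\<^sub>R axis i 1)"
    using E1 E2 unfolding swap by argo
  then have "?A (x + \<sigma> *\<^sub>R axis i 1 + \<tau> *\<^sub>R axis j 1) = ?B (x + \<sigma>' *\<^sub>R axis j 1 + \<tau>' *\<^sub>R axis i 1)"
    using s by simp
  moreover have "dist (?A (x + \<sigma> *\<^sub>R axis i 1 + \<tau> *\<^sub>R axis j 1)) (?A x) < \<epsilon>"
    using d1(2) near[OF st] by simp
  moreover have "dist (?B (x + \<sigma>' *\<^sub>R axis j 1 + \<tau>' *\<^sub>R axis i 1)) (?B x) < \<epsilon>"
    using d2(2) near[OF st'] by simp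
  ultimately have "\<bar>?A x - ?B x\<bar> < 2 * \<epsilon>" by (simp add: dist_real_def)
  then show False unfolding \<epsilon>_def by simp
qed

lemma Hess_commute:
  assumes "smooth_fun h"
  shows "Hess a b h x = Hess b a h x"
proof -
  have "Hess b a h x = (\<Sum>j\<in>UNIV. \<Sum>i\<in>UNIV. a x $ i * pd i (pd j h) x * b x $ j)"
    unfolding Hess_def by (rule sum.swap)
  also have "\<dots> = (\<Sum>j\<in>UNIV. \<Sum>i\<in>UNIV. b x $ j * pd j (pd i h) x * a x $ i)"
    by (intro sum.cong refl) (simp add: pd_pd_commute[OF assms] mult.commute mult.left_commute)
  finally show ?thesis unfolding Hess_def by simp
qed

section \<open>The Ito rate along the system\<close>

lemma Lie_add_scaleR: "Lie (\<lambda>y. f y + u *\<^sub>R g y) h x = Lie f h x + u * Lie g h x"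
  unfolding Lie_def by (simp add: algebra_simps sum.distrib sum_distrib_left)

lemma Hess_add_scaleR:
  "Hess (\<lambda>y. l y + u *\<^sub>R m y) (\<lambda>y. l y + u *\<^sub>R m y) h x
    = Hess l l h x + u * Hess l m h x + u * Hess m l h x + u\<^sup>2 * Hess m m h x"
proof -
  have "Hess (\<lambda>y. l y + u *\<^sub>R m y) (\<lambda>y. l y + u *\<^sub>R m y) h x
     = (\<Sum>i\<in>UNIV. \<Sum>j\<in>UNIV. l x $ i * pd i (pd j h) x * l x $ j
         + u * (m x $ i * pd i (pd j h) x * l x $ j) + u * (l x $ i * pd i (pd j h) x * m x $ j)
         + u\<^sup>2 * (m x $ i * pd i (pd j h) x * m x $ j))"
    unfolding Hess_def by (intro sum.cong refl) (simp add: algebra_simps power2_eq_square)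
  then show ?thesis by (simp add: Hess_def sum.distrib sum_distrib_left)
qed

text \<open>The cross terms H_{l,m} and H_{m,l} merge by symmetry of the Hessian.\<close>
lemma ito_rate_eq:
  assumes "smooth_fun \<phi>"
  shows "ito_rate f g l m \<phi> \<xi> u x
    = Sop f l \<phi> \<xi> x + Aop l m g \<phi> \<xi> x * u + 1/2 * Hess m m \<phi> x * u\<^sup>2"
  unfolding ito_rate_def Lie_add_scaleR Hess_add_scaleR Sop_def Aop_def
    Hess_commute[OF assms, of m l]
  by (simp add: algebra_simps)

lemma stoch_rel_degree_ito_rate_Siter:
  assumes smooth: "smooth_vf f" "smooth_vf l" "smooth_fun h"
    and reldeg: "stoch_rel_degree f g l m h r xbar"
  obtains U0 where "open U0" "xbar \<in> U0"
    "\<And>i x \<xi> u. i \<in> {1..<r} \<Longrightarrow> x \<in> U0 \<Longrightarrow>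
       ito_rate f g l m (Siter (i - 1) f l h) \<xi> u x = Siter i f l h x"
proof -
  obtain U0 where "open U0" "xbar \<in> U0" and conditions:
    "\<And>k x. k + 2 \<le> r \<Longrightarrow> x \<in> U0 \<Longrightarrow>
        Lie l (Siter k f l h) x = 0 \<and> Lie m (Siter k f l h) x = 0 \<and>
        Lie g (Siter k f l h) x + Hess l m (Siter k f l h) x = 0 \<and>
        Hess m m (Siter k f l h) x = 0"
    using reldeg unfolding stoch_rel_degree_def by metis
  moreover have "ito_rate f g l m (Siter (i - 1) f l h) \<xi> u x = Siter i f l h x"
    if "i \<in> {1..<r}" "x \<in> U0" for i x \<xi> u
  proof -
    obtain k where "i = Suc k" "k + 2 \<le> r"
      using \<open>i \<in> {1..<r}\<close> by (cases i) auto
    then show ?thesis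
      using ito_rate_eq[OF smooth_fun_Siter[OF smooth]] conditions[of k x] \<open>x \<in> U0\<close>
      by (simp add: Sop_def Aop_def)
  qed
  ultimately show ?thesis using that by blast
qed

lemma Sop_Aop_affine:
  "\<exists>\<alpha>1 \<beta>1 \<alpha>2 \<beta>2. \<forall>\<xi>. Sop f l \<psi> \<xi> y = \<alpha>1 + \<beta>1 * \<xi> \<and> Aop l m g \<psi> \<xi> y = \<alpha>2 + \<beta>2 * \<xi>"
  unfolding Sop_def Aop_def
  by (rule exI[of _ "Lie f \<psi> y + 1/2 * Hess l l \<psi> y"], rule exI[of _ "Lie l \<psi> y"],
      rule exI[of _ "Lie g \<psi> y + Hess l m \<psi> y"], rule exI[of _ "Lie m \<psi> y"])
     (simp add: algebra_simps)

section \<open>Local charts\<close>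

lemma vec_lambda_eq_sum_axis: "(\<chi> k. c k) = (\<Sum>k\<in>UNIV. c k *\<^sub>R axis k (1::real))"
  by (simp add: vec_eq_iff sum_component axis_def if_distrib cong: if_cong)

lemma has_derivative_vec_lambda_pd:
  fixes F :: "'k::finite \<Rightarrow> real^'n::finite \<Rightarrow> real"
  assumes "\<And>k. F k differentiable (at x)"
  shows "((\<lambda>y. \<chi> k. F k y) has_derivative (*v) (\<chi> k j. pd j (F k) x)) (at x)"
proof -
  have "((\<lambda>y. \<Sum>k\<in>UNIV. F k y *\<^sub>R axis k 1) has_derivative
      (\<lambda>v. \<Sum>k\<in>UNIV. (\<Sum>j\<in>UNIV. pd j (F k) x * v $ j) *\<^sub>R axis k 1)) (at x)"
    by (intro has_derivative_sum has_derivative_scaleR_left has_derivative_pd assms)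
  moreover have "(\<lambda>y. \<chi> k. F k y) = (\<lambda>y. \<Sum>k\<in>UNIV. F k y *\<^sub>R axis k 1)"
    by (simp add: vec_lambda_eq_sum_axis)
  moreover have "(*v) (\<chi> k j. pd j (F k) x)
      = (\<lambda>v. \<Sum>k\<in>UNIV. (\<Sum>j\<in>UNIV. pd j (F k) x * v $ j) *\<^sub>R axis k 1)"
    by (rule ext, subst vec_lambda_eq_sum_axis[symmetric]) (simp add: matrix_vector_mult_def)
  ultimately show ?thesis by simp
qed

lemma rows_jacobian_pd: "rows (\<chi> k j. pd j (F k) x) = range (\<lambda>k. grad (F k) x)"
  by (auto simp: rows_def row_def grad_def)

text \<open>The operator-norm distance of the Jacobians is bounded by the entrywise l1 distance, which is
  continuous and vanishes at a; this is the hypothesis of has_derivative_locally_injective.\<close>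
lemma locally_injective_if_gradients_span:
  fixes F :: "'n::finite \<Rightarrow> real^'n \<Rightarrow> real"
  assumes smooth: "\<And>k. smooth_fun (F k)"
    and span: "span (range (\<lambda>k. grad (F k) a)) = UNIV"
  shows "\<exists>\<rho>>0. inj_on (\<lambda>x. \<chi> k. F k x) (ball a \<rho>)"
proof -
  define J where "J = (\<lambda>x. \<chi> k j. pd j (F k) x)"
  have deriv: "((\<lambda>y. \<chi> k. F k y) has_derivative (*v) (J x)) (at x)" for x
    unfolding J_def by (intro has_derivative_vec_lambda_pd smooth_fun_differentiable smooth)
  obtain B where B: "B ** J a = mat 1"
    using matrix_left_invertible_span_rows[of "J a"] span by (auto simp: J_def rows_jacobian_pd)
  then have left_inverse: "(*v) B \<circ> (*v) (J a) = id"
    by (simp add: fun_eq_iff matrix_vector_mul_assoc)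
  define S where "S = (\<lambda>x. \<Sum>k\<in>UNIV. \<Sum>j\<in>UNIV. \<bar>(J x - J a) $ k $ j\<bar>)"
  have "S = (\<lambda>x. \<Sum>k\<in>UNIV. \<Sum>j\<in>UNIV. \<bar>pd j (F k) x - pd j (F k) a\<bar>)"
    by (simp add: S_def J_def)
  then have "isCont S a"
    by (simp only:) (intro continuous_intros smooth_fun_isCont smooth_fun_pd smooth)
  have "S a = 0" by (simp add: S_def)
  have onorm_le: "onorm (\<lambda>v. J x *v v - J a *v v) \<le> S x" for x
  proof -
    have "(\<lambda>v. J x *v v - J a *v v) = (*v) (J x - J a)"
      by (simp add: fun_eq_iff matrix_vector_mult_diff_rdistrib)
    then show ?thesis
      using onorm_le_matrix_component_sum[of "J x - J a"] by (simp add: S_def)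
  qed
  have "\<exists>d>0. \<forall>x. dist a x < d \<longrightarrow> onorm (\<lambda>v. J x *v v - J a *v v) < e"
    if "e > 0" for e
  proof -
    obtain d where d: "d > 0" "\<And>x. dist x a < d \<Longrightarrow> dist (S x) (S a) < e"
      using \<open>isCont S a\<close> \<open>e > 0\<close> unfolding continuous_at_eps_delta by blast
    moreover have "S x < e" if "dist a x < d" for x
      using d(2)[of x] that \<open>S a = 0\<close> by (simp add: dist_commute dist_real_def)
    ultimately show ?thesis using onorm_le le_less_trans by blast
  qed
  then obtain \<rho> where "\<rho> > 0" "inj_on (\<lambda>x. \<chi> k. F k x) (ball a \<rho>)"
    using has_derivative_locally_injective[OF UNIV_I open_UNIV matrix_vector_mul_bounded_linear
        left_inverse deriv] by blast
  then show ?thesis by blast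
qed

lemma span_eq_UNIV_if_rows_lin_indep:
  fixes \<phi> :: "nat \<Rightarrow> real^'n::finite \<Rightarrow> real"
  assumes "rows_lin_indep \<phi> {1..CARD('n)} a"
  shows "span ((\<lambda>i. grad (\<phi> i) a) ` {1..CARD('n)}) = UNIV"
  using assms card_eq_dim[of "(\<lambda>i. grad (\<phi> i) a) ` {1..CARD('n)}" UNIV]
  by (auto simp: rows_lin_indep_def card_image)

text \<open>Invariance of domain supplies the continuity of the inverse.\<close>
lemma homeomorphism_the_inv_into_if_inj_projection:
  fixes \<Phi> :: "'a::euclidean_space \<Rightarrow> 'b::topological_space" and P :: "'b \<Rightarrow> 'a"
  assumes U: "open U" and cont: "continuous_on U \<Phi>" "continuous_on (\<Phi> ` U) P"
    and inj: "inj_on (P \<circ> \<Phi>) U"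
  shows "inj_on \<Phi> U \<and> homeomorphism U (\<Phi> ` U) \<Phi> (the_inv_into U \<Phi>)"
proof
  show inj\<Phi>: "inj_on \<Phi> U"
    using inj by (auto simp: inj_on_def)
  have "continuous_on U (P \<circ> \<Phi>)"
    using cont by (rule continuous_on_compose)
  then obtain g where g: "homeomorphism U ((P \<circ> \<Phi>) ` U) (P \<circ> \<Phi>) g"
    using invariance_of_domain_homeomorphism[OF U _ order_refl inj] by blast
  have inv: "the_inv_into U \<Phi> z = g (P z)" if "z \<in> \<Phi> ` U" for z
    using that g the_inv_into_f_f[OF inj\<Phi>] unfolding homeomorphism_def by auto
  have "continuous_on (\<Phi> ` U) (g \<circ> P)"
    by (rule continuous_on_compose[OF cont(2)])
       (use g in \<open>simp add: homeomorphism_def image_comp\<close>)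
  then have "continuous_on (\<Phi> ` U) (the_inv_into U \<Phi>)"
    using inv continuous_on_eq by (metis comp_apply)
  with cont(1) inj\<Phi> show "homeomorphism U (\<Phi> ` U) \<Phi> (the_inv_into U \<Phi>)"
    unfolding homeomorphism_def by (auto simp: the_inv_into_f_f f_the_inv_into_f image_iff)
qed

lemma local_chart:
  fixes \<phi> :: "nat \<Rightarrow> real^'n::finite \<Rightarrow> real"
  assumes smooth: "\<And>j. j \<in> {1..CARD('n)} \<Longrightarrow> smooth_fun (\<phi> j)"
    and indep: "rows_lin_indep \<phi> {1..CARD('n)} a"
  defines "\<Phi> \<equiv> \<lambda>x i. if i \<in> {1..CARD('n)} then \<phi> i x else 0"
  shows "\<exists>\<rho>>0. \<forall>U. open U \<longrightarrow> U \<subseteq> ball a \<rho> \<longrightarrow>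
           inj_on \<Phi> U \<and> homeomorphism U (\<Phi> ` U) \<Phi> (the_inv_into U \<Phi>)"
proof -
  obtain idx :: "'n \<Rightarrow> nat" where idx: "bij_betw idx UNIV {1..CARD('n)}"
    using finite_same_card_bij[of "UNIV :: 'n set" "{1..CARD('n)}"] by auto
  then have idx_range: "range idx = {1..CARD('n)}" by (simp add: bij_betw_def)
  define P where "P = (\<lambda>z. \<chi> k. z (idx k) :: real^'n)"
  have idx_in: "idx k \<in> {1..CARD('n)}" for k
    using idx_range by blast
  have P\<Phi>: "P (\<Phi> x) = (\<chi> k. \<phi> (idx k) x)" for x
    using idx_in by (simp add: P_def \<Phi>_def)
  have "range (\<lambda>k. grad (\<phi> (idx k)) a) = (\<lambda>i. grad (\<phi> i) a) ` {1..CARD('n)}"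
    unfolding idx_range[symmetric] by (simp only: image_image)
  then have "span (range (\<lambda>k. grad (\<phi> (idx k)) a)) = UNIV"
    by (simp only: span_eq_UNIV_if_rows_lin_indep[OF indep])
  moreover have "smooth_fun (\<phi> (idx k))" for k
    using smooth idx_in by blast
  ultimately obtain \<rho> where \<rho>: "\<rho> > 0" "inj_on (\<lambda>x. \<chi> k. \<phi> (idx k) x) (ball a \<rho>)"
    using locally_injective_if_gradients_span[of "\<lambda>k. \<phi> (idx k)" a] by auto
  have cont\<Phi>: "continuous_on U \<Phi>" for U
  proof (rule continuous_on_coordinatewise_then_product)
    show "continuous_on U (\<lambda>x. \<Phi> x i)" for i
      using smooth by (cases "i \<in> {1..CARD('n)}")
        (auto simp: \<Phi>_def smooth_fun_const intro!: continuous_at_imp_continuous_on smooth_fun_isCont)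
  qed
  have contP: "continuous_on V P" for V
    unfolding P_def
    by (intro continuous_on_vec_lambda continuous_on_subset[OF continuous_on_product_coordinates])
       auto
  have "inj_on \<Phi> U \<and> homeomorphism U (\<Phi> ` U) \<Phi> (the_inv_into U \<Phi>)"
    if "open U" "U \<subseteq> ball a \<rho>" for U
  proof (rule homeomorphism_the_inv_into_if_inj_projection[OF \<open>open U\<close> cont\<Phi> contP])
    show "inj_on (P \<circ> \<Phi>) U"
      using inj_on_subset[OF \<rho>(2) that(2)] by (simp add: P\<Phi> inj_on_def)
  qed
  with \<rho>(1) show ?thesis by blast
qed

lemma smooth_coordinates_extend:
  fixes \<psi> :: "nat \<Rightarrow> real^'n::finite \<Rightarrow> real"
  assumes smooth: "\<And>k. k < r \<Longrightarrow> smooth_fun (\<psi> k)"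
    and indep: "rows_lin_indep \<psi> {0..<r} a" and r: "r \<le> CARD('n)"
  shows "\<exists>\<phi>. (\<forall>i\<in>{1..r}. \<phi> i = \<psi> (i - 1)) \<and> (\<forall>j\<in>{1..CARD('n)}. smooth_fun (\<phi> j)) \<and>
             rows_lin_indep \<phi> {1..CARD('n)} a"
proof -
  define S where "S = (\<lambda>k. grad (\<psi> k) a) ` {0..<r}"
  have "independent S" and cardS: "card S = r"
    using indep by (auto simp: S_def rows_lin_indep_def card_image)
  then obtain B where B: "S \<subseteq> B" "independent B" "UNIV \<subseteq> span B"
    using maximal_independent_subset_extend[OF subset_UNIV] by metis
  then have "finite B" "card B = CARD('n)"
    using independent_bound basis_card_eq_dim[OF subset_UNIV B(3,2)] by auto
  then have "card (B - S) = CARD('n) - r"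
    using B(1) cardS by (simp add: card_Diff_subset finite_subset)
  then obtain e where e: "bij_betw e {r+1..CARD('n)} (B - S)"
    using finite_same_card_bij[of "{r+1..CARD('n)}" "B - S"] \<open>finite B\<close> by auto
  \<comment> \<open>the gradients of the new coordinates are the basis vectors completing S\<close>
  define \<phi> where "\<phi> = (\<lambda>i. if i \<le> r then \<psi> (i - 1) else (\<lambda>x. e i \<bullet> x))"
  define Gr where "Gr = (\<lambda>i. grad (\<phi> i) a)"
  have "Gr ` {1..r} = S"
    unfolding S_def Gr_def \<phi>_def atLeastLessThanSuc_atLeastAtMost[symmetric]
    by (simp flip: image_Suc_atLeastLessThan add: image_image)
  moreover have "Gr ` {r+1..CARD('n)} = B - S"
    using e by (auto simp: Gr_def \<phi>_def grad_inner bij_betw_def)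
  moreover have "{1..CARD('n)} = {1..r} \<union> {r+1..CARD('n)}"
    using r by auto
  ultimately have img: "Gr ` {1..CARD('n)} = B"
    using B(1) by (simp add: image_Un Un_absorb1)
  then have "inj_on Gr {1..CARD('n)}"
    by (simp add: inj_on_iff_eq_card \<open>card B = CARD('n)\<close>)
  then have "rows_lin_indep \<phi> {1..CARD('n)} a"
    using img B(2) by (simp add: rows_lin_indep_def Gr_def)
  moreover have "smooth_fun (\<phi> j)" if "j \<in> {1..CARD('n)}" for j
    using smooth that by (auto simp: \<phi>_def smooth_fun_inner)
  moreover have "\<forall>i\<in>{1..r}. \<phi> i = \<psi> (i - 1)"
    by (simp add: \<phi>_def)
  ultimately show ?thesis by blast
qed

theorem proposition2:
  fixes f g l m :: "real^'n::finite \<Rightarrow> real^'n"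
    and h :: "real^'n \<Rightarrow> real" and xbar :: "real^'n" and r :: nat
  assumes smooth: "smooth_vf f" "smooth_vf g" "smooth_vf l" "smooth_vf m" "smooth_fun h"
    and reldeg: "stoch_rel_degree f g l m h r xbar"
    and indep: "rows_lin_indep (\<lambda>k. Siter k f l h) {0..<r} xbar"
    and rn: "r < CARD('n)"
  shows "\<exists>\<phi> :: nat \<Rightarrow> real^'n \<Rightarrow> real.
    (\<forall>i\<in>{1..r}. \<phi> i = Siter (i - 1) f l h) \<and>
    (\<forall>j\<in>{1..CARD('n)}. smooth_fun (\<phi> j)) \<and>
    rows_lin_indep \<phi> {1..CARD('n)} xbar \<and>
    (let \<Phi> = (\<lambda>x. \<lambda>i::nat. if i \<in> {1..CARD('n)} then \<phi> i x else 0) in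
     \<exists>U. open U \<and> xbar \<in> U \<and> inj_on \<Phi> U \<and>
       homeomorphism U (\<Phi> ` U) \<Phi> (the_inv_into U \<Phi>) \<and>
       (let \<Phi>inv = the_inv_into U \<Phi>;
            c = (\<lambda>\<xi> z. Sop f l (Siter (r - 1) f l h) \<xi> (\<Phi>inv z));
            b = (\<lambda>\<xi> z. Aop l m g (Siter (r - 1) f l h) \<xi> (\<Phi>inv z));
            a = (\<lambda>z. 1/2 * Hess m m (Siter (r - 1) f l h) (\<Phi>inv z));
            p = (\<lambda>j \<xi> z. Sop f l (\<phi> j) \<xi> (\<Phi>inv z));
            q = (\<lambda>j \<xi> z. Aop l m g (\<phi> j) \<xi> (\<Phi>inv z));
            s = (\<lambda>j z. 1/2 * Hess m m (\<phi> j) (\<Phi>inv z))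
        in (\<forall>x\<in>U. \<forall>\<xi> u.
              (\<forall>i\<in>{1..<r}. ito_rate f g l m (\<phi> i) \<xi> u x = \<Phi> x (i + 1)) \<and>
              ito_rate f g l m (\<phi> r) \<xi> u x
                = c \<xi> (\<Phi> x) + b \<xi> (\<Phi> x) * u + a (\<Phi> x) * u\<^sup>2 \<and>
              (\<forall>j\<in>{r+1..CARD('n)}. ito_rate f g l m (\<phi> j) \<xi> u x
                = p j \<xi> (\<Phi> x) + q j \<xi> (\<Phi> x) * u + s j (\<Phi> x) * u\<^sup>2) \<and>
              h x = \<Phi> x 1) \<and>
           (\<forall>z\<in>\<Phi> ` U. \<exists>\<alpha>1 \<beta>1 \<alpha>2 \<beta>2. \<forall>\<xi>.
              c \<xi> z = \<alpha>1 + \<beta>1 * \<xi> \<and> b \<xi> z = \<alpha>2 + \<beta>2 * \<xi>) \<and>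
           (\<forall>j\<in>{r+1..CARD('n)}. \<forall>z\<in>\<Phi> ` U. \<exists>\<alpha>1 \<beta>1 \<alpha>2 \<beta>2. \<forall>\<xi>.
              p j \<xi> z = \<alpha>1 + \<beta>1 * \<xi> \<and> q j \<xi> z = \<alpha>2 + \<beta>2 * \<xi>)))"
proof -
  let ?n = "CARD('n)"
  obtain U0 where U0: "open U0" "xbar \<in> U0" and Siter_chain:
    "\<And>i x \<xi> u. i \<in> {1..<r} \<Longrightarrow> x \<in> U0 \<Longrightarrow>
       ito_rate f g l m (Siter (i - 1) f l h) \<xi> u x = Siter i f l h x"
    using stoch_rel_degree_ito_rate_Siter[OF smooth(1,3,5) reldeg] by blast
  have r: "1 \<le> r" "r \<le> ?n"
    using reldeg rn by (auto simp: stoch_rel_degree_def)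
  obtain \<phi> where \<phi>: "\<forall>i\<in>{1..r}. \<phi> i = Siter (i - 1) f l h"
      "\<forall>j\<in>{1..?n}. smooth_fun (\<phi> j)" "rows_lin_indep \<phi> {1..?n} xbar"
    using smooth_coordinates_extend[OF smooth_fun_Siter[OF smooth(1,3,5)] indep r(2)] by blast
  define \<Phi> where "\<Phi> = (\<lambda>x. \<lambda>i::nat. if i \<in> {1..?n} then \<phi> i x else 0)"
  obtain \<rho> where "\<rho> > 0" and chart: "\<And>U. open U \<Longrightarrow> U \<subseteq> ball xbar \<rho> \<Longrightarrow>
      inj_on \<Phi> U \<and> homeomorphism U (\<Phi> ` U) \<Phi> (the_inv_into U \<Phi>)"
    using local_chart[of \<phi> xbar] \<phi>(2,3) unfolding \<Phi>_def by blast
  define U where "U = ball xbar \<rho> \<inter> U0"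
  have U: "open U" "xbar \<in> U" "inj_on \<Phi> U" "homeomorphism U (\<Phi> ` U) \<Phi> (the_inv_into U \<Phi>)"
    using U0 \<open>\<rho> > 0\<close> chart[of U] by (auto simp: U_def)
  have chain: "ito_rate f g l m (\<phi> i) \<xi> u x = \<Phi> x (i + 1)"
    if "x \<in> U" "i \<in> {1..<r}" for x i \<xi> u
    using that r \<phi>(1) Siter_chain[of i x] by (simp add: U_def \<Phi>_def)
  have "h x = \<Phi> x 1" for x
    using r \<phi>(1) by (simp add: \<Phi>_def)
  moreover have "the_inv_into U \<Phi> (\<Phi> x) = x" if "x \<in> U" for x
    using the_inv_into_f_f[OF U(3) that] .
  ultimately show ?thesis
  proof (intro exI[of _ \<phi>], subst \<Phi>_def[symmetric], unfold Let_def, intro exI[of _ U] conjI)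
  qed (use \<phi> U chain r in
        \<open>auto simp: ito_rate_eq smooth_fun_Siter[OF smooth(1,3,5)] intro: Sop_Aop_affine\<close>)
qed

end
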